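(* Let $m,n\geq 1$ be integers and let $\mathbb{B}(\ell_\infty^n,\ell_1^m)$ be the space of linear operators from $\ell_\infty^n$ to $\ell_1^m$ over $\mathbb{R}$ with the operator norm. If a non-zero element $T\in\mathbb{B}(\ell_\infty^n,\ell_1^m)$ is left-symmetric, then $T$ is a smooth point of $\mathbb{B}(\ell_\infty^n,\ell_1^m)$.
   Context: $\ell_\infty^n$ is $\mathbb{R}^n$ with norm $\max_i|x_i|$, and $\ell_1^m$ is $\mathbb{R}^m$ with norm $\sum_i|x_i|$. For elements $x,y$ of a real normed linear space $\mathbb{X}$, $x$ is Birkhoff-James orthogonal to $y$, written $x\perp_B y$, if $\|x+\lambda y\|\geq\|x\|$ for every $\lambda\in\mathbb{R}$. An element $x\in\mathbb{X}$ is left-symmetric if for every $y\in\mathbb{X}$, $x\perp_B y$ implies $y\perp_B x$. A support functional of a non-zero $x\in\mathbb{X}$ is a functional $f\in\mathbb{X}^*$ with $\|f\|=1$ and $f(x)=\|x\|$. A non-zero $x$ is smooth if it has a unique support functional. *)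

theory Defs
  imports "HOL-Analysis.Analysis"
begin

(* The library norm on real ^ 'n is the Euclidean one, so the spaces l_infty^n and l_1^m, with
   n = CARD('n) and m = CARD('m), are introduced as copies of real ^ 'n carrying the maximum
   norm and the sum norm.  Operators between them are then elements of the library type of
   bounded linear functions, whose norm is the operator norm. *)

typedef ('n :: finite) linf = "UNIV :: (real ^ 'n) set"
  morphisms vec_linf linf_vec
  by simp

setup_lifting type_definition_linf

typedef ('m :: finite) lone = "UNIV :: (real ^ 'm) set"
  morphisms vec_lone lone_vec
  by simp

setup_lifting type_definition_lone

instantiation linf :: (finite) real_vector
begin

lift_definition zero_linf :: "'a linf" is 0 .
lift_definition plus_linf :: "'a linf \<Rightarrow> 'a linf \<Rightarrow> 'a linf" is "(+)" .
lift_definition minus_linf :: "'a linf \<Rightarrow> 'a linf \<Rightarrow> 'a linf" is "(-)" .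
lift_definition uminus_linf :: "'a linf \<Rightarrow> 'a linf" is uminus .
lift_definition scaleR_linf :: "real \<Rightarrow> 'a linf \<Rightarrow> 'a linf" is "(*\<^sub>R)" .

instance
  by standard (transfer, simp add: algebra_simps)+

end

instantiation lone :: (finite) real_vector
begin

lift_definition zero_lone :: "'a lone" is 0 .
lift_definition plus_lone :: "'a lone \<Rightarrow> 'a lone \<Rightarrow> 'a lone" is "(+)" .
lift_definition minus_lone :: "'a lone \<Rightarrow> 'a lone \<Rightarrow> 'a lone" is "(-)" .
lift_definition uminus_lone :: "'a lone \<Rightarrow> 'a lone" is uminus .
lift_definition scaleR_lone :: "real \<Rightarrow> 'a lone \<Rightarrow> 'a lone" is "(*\<^sub>R)" .

instance
  by standard (transfer, simp add: algebra_simps)+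

end

lemma Max_abs_triangle:
  fixes x y :: "real ^ 'n :: finite"
  shows "Max (range (\<lambda>i. \<bar>(x + y) $ i\<bar>)) \<le>
    Max (range (\<lambda>i. \<bar>x $ i\<bar>)) + Max (range (\<lambda>i. \<bar>y $ i\<bar>))"
proof -
  have "\<bar>(x + y) $ i\<bar> \<le> Max (range (\<lambda>i. \<bar>x $ i\<bar>)) + Max (range (\<lambda>i. \<bar>y $ i\<bar>))" for i
  proof -
    have "\<bar>x $ i\<bar> \<le> Max (range (\<lambda>i. \<bar>x $ i\<bar>))" "\<bar>y $ i\<bar> \<le> Max (range (\<lambda>i. \<bar>y $ i\<bar>))"
      by (auto intro!: Max_ge)
    then show ?thesis unfolding vector_add_component by linarith
  qed
  then show ?thesis by (subst Max_le_iff) auto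
qed

lemma Max_abs_eq_0:
  fixes x :: "real ^ 'n :: finite"
  shows "Max (range (\<lambda>i. \<bar>x $ i\<bar>)) = 0 \<longleftrightarrow> x = 0"
proof
  assume *: "Max (range (\<lambda>i. \<bar>x $ i\<bar>)) = 0"
  have "\<bar>x $ i\<bar> \<le> Max (range (\<lambda>i. \<bar>x $ i\<bar>))" for i
    by (auto intro!: Max_ge)
  with * show "x = 0" by (simp add: vec_eq_iff)
qed simp

lemma Max_abs_scaleR:
  fixes x :: "real ^ 'n :: finite"
  shows "Max (range (\<lambda>i. \<bar>(a *\<^sub>R x) $ i\<bar>)) = \<bar>a\<bar> * Max (range (\<lambda>i. \<bar>x $ i\<bar>))"
proof -
  have "mono ((*) \<bar>a\<bar>)" by (auto intro!: monoI mult_left_mono)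
  from mono_Max_commute[OF this, of "range (\<lambda>i. \<bar>x $ i\<bar>)"] show ?thesis
    by (simp add: image_image abs_mult)
qed

instantiation linf :: (finite) real_normed_vector
begin

lift_definition norm_linf :: "'a linf \<Rightarrow> real" is "\<lambda>x. Max (range (\<lambda>i. \<bar>x $ i\<bar>))" .

definition sgn_linf :: "'a linf \<Rightarrow> 'a linf"
  where "sgn_linf x = x /\<^sub>R norm x"

definition dist_linf :: "'a linf \<Rightarrow> 'a linf \<Rightarrow> real"
  where "dist_linf x y = norm (x - y)"

definition uniformity_linf :: "('a linf \<times> 'a linf) filter"
  where "uniformity_linf = (INF e\<in>{0<..}. principal {(x, y). dist x y < e})"

definition open_linf :: "'a linf set \<Rightarrow> bool"
  where "open_linf U \<longleftrightarrow> (\<forall>x\<in>U. eventually (\<lambda>(x', y). x' = x \<longrightarrow> y \<in> U) uniformity)"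

instance
proof
  fix x y :: "'a linf" and a :: real
  show "norm x = 0 \<longleftrightarrow> x = 0"
    by transfer (rule Max_abs_eq_0)
  show "norm (x + y) \<le> norm x + norm y"
    by transfer (rule Max_abs_triangle)
  show "norm (a *\<^sub>R x) = \<bar>a\<bar> * norm x"
    by transfer (rule Max_abs_scaleR)
qed (simp_all add: sgn_linf_def dist_linf_def uniformity_linf_def open_linf_def)

end

instantiation lone :: (finite) real_normed_vector
begin

lift_definition norm_lone :: "'a lone \<Rightarrow> real" is "\<lambda>x. \<Sum>i\<in>UNIV. \<bar>x $ i\<bar>" .

definition sgn_lone :: "'a lone \<Rightarrow> 'a lone"
  where "sgn_lone x = x /\<^sub>R norm x"

definition dist_lone :: "'a lone \<Rightarrow> 'a lone \<Rightarrow> real"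
  where "dist_lone x y = norm (x - y)"

definition uniformity_lone :: "('a lone \<times> 'a lone) filter"
  where "uniformity_lone = (INF e\<in>{0<..}. principal {(x, y). dist x y < e})"

definition open_lone :: "'a lone set \<Rightarrow> bool"
  where "open_lone U \<longleftrightarrow> (\<forall>x\<in>U. eventually (\<lambda>(x', y). x' = x \<longrightarrow> y \<in> U) uniformity)"

instance
proof
  fix x y :: "'a lone" and a :: real
  show "norm x = 0 \<longleftrightarrow> x = 0"
    by transfer (simp add: sum_nonneg_eq_0_iff vec_eq_iff)
  show "norm (x + y) \<le> norm x + norm y"
    by transfer (simp add: sum.distrib[symmetric] sum_mono abs_triangle_ineq)
  show "norm (a *\<^sub>R x) = \<bar>a\<bar> * norm x"
    by transfer (simp add: abs_mult sum_distrib_left)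
qed (simp_all add: sgn_lone_def dist_lone_def uniformity_lone_def open_lone_def)

end

(* Every linear operator on l_infty^n is bounded, so the type 'n linf \<Rightarrow>\<^sub>L 'm lone is the space
   of all linear operators. *)

lemma linear_linf_bounded_linear:
  fixes f :: "'n :: finite linf \<Rightarrow> 'b :: real_normed_vector"
  assumes "linear f"
  shows "bounded_linear f"
proof -
  interpret f: linear f by fact
  interpret v: linear "linf_vec :: real ^ 'n \<Rightarrow> 'n linf"
    by standard (transfer, simp)+
  define e :: "'n \<Rightarrow> 'n linf" where "e i = linf_vec (axis i 1)" for i
  have exp: "x = (\<Sum>i\<in>UNIV. (vec_linf x $ i) *\<^sub>R e i)" for x :: "'n linf"
  proof -
    have "x = linf_vec (vec_linf x)" by (simp add: vec_linf_inverse)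
    also have "vec_linf x = (\<Sum>i\<in>UNIV. (vec_linf x $ i) *\<^sub>R axis i 1)"
      by (simp add: basis_expansion flip: scalar_mult_eq_scaleR)
    also have "linf_vec \<dots> = (\<Sum>i\<in>UNIV. (vec_linf x $ i) *\<^sub>R e i)"
      by (simp add: v.sum v.scaleR e_def)
    finally show ?thesis .
  qed
  have "norm (f x) \<le> norm x * (\<Sum>i\<in>UNIV. norm (f (e i)))" for x
  proof -
    have coord: "\<bar>vec_linf x $ i\<bar> \<le> norm x" for i
      unfolding norm_linf.rep_eq by (auto intro!: Max_ge)
    have "norm (f x) = norm (\<Sum>i\<in>UNIV. (vec_linf x $ i) *\<^sub>R f (e i))"
      by (subst exp) (simp add: f.sum f.scaleR)
    also have "\<dots> \<le> (\<Sum>i\<in>UNIV. \<bar>vec_linf x $ i\<bar> * norm (f (e i)))"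
      by (rule order_trans[OF norm_sum]) simp
    also have "\<dots> \<le> (\<Sum>i\<in>UNIV. norm x * norm (f (e i)))"
      by (intro sum_mono mult_right_mono coord) simp
    finally show ?thesis by (simp add: sum_distrib_left)
  qed
  then show ?thesis
    by (intro bounded_linear_intro[where K = "\<Sum>i\<in>UNIV. norm (f (e i))"])
      (simp_all add: f.add f.scaleR)
qed

definition BJ_orthogonal :: "'a :: real_normed_vector \<Rightarrow> 'a \<Rightarrow> bool"  (infix "\<bottom>\<^sub>B" 50)
  where "x \<bottom>\<^sub>B y \<longleftrightarrow> (\<forall>l :: real. norm (x + l *\<^sub>R y) \<ge> norm x)"

definition left_symmetric :: "'a :: real_normed_vector \<Rightarrow> bool"
  where "left_symmetric x \<longleftrightarrow> (\<forall>y. x \<bottom>\<^sub>B y \<longrightarrow> y \<bottom>\<^sub>B x)"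

definition support_functional :: "'a :: real_normed_vector \<Rightarrow> ('a \<Rightarrow>\<^sub>L real) \<Rightarrow> bool"
  where "support_functional x f \<longleftrightarrow> x \<noteq> 0 \<and> norm f = 1 \<and> blinfun_apply f x = norm x"

definition smooth_point :: "'a :: real_normed_vector \<Rightarrow> bool"
  where "smooth_point x \<longleftrightarrow> x \<noteq> 0 \<and> (\<exists>!f. support_functional x f)"

end

theory Submission
  imports Defs
begin

text \<open>
  The norm of an operator \<open>T\<close> with matrix \<open>(t\<^sub>i\<^sub>j)\<close> is the maximum of \<open>\<Sum> S\<^sub>i\<^sub>j t\<^sub>i\<^sub>j\<close> over the
  sign matrices \<open>S\<close> of rank one, so \<open>T\<close> is smooth once the maximum is attained by only one \<open>S\<close>.
  If two matrices \<open>S \<noteq> S'\<close> attain it, let \<open>y\<^sub>i\<^sub>j = w\<^sub>i\<^sub>j S\<^sub>i\<^sub>j\<close> with weights \<open>w\<^sub>i\<^sub>j > 0\<close> that are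
  very large at one entry where \<open>S\<close> and \<open>S'\<close> differ. Then \<open>S\<close> is the only norming matrix of \<open>y\<close>,
  so \<open>y\<close> is not orthogonal to \<open>T\<close>; but \<open>T\<close> is orthogonal to \<open>y\<close>, because \<open>S\<close> and \<open>S'\<close> both norm
  \<open>T\<close> and take values of opposite sign at \<open>y\<close>.
\<close>

section \<open>Norms that are maxima of finitely many functionals\<close>

definition norming_set :: "('a :: real_normed_vector \<Rightarrow>\<^sub>L real) set \<Rightarrow> bool"
  where "norming_set E \<longleftrightarrow> finite E \<and> (\<forall>f\<in>E. \<forall>x. f x \<le> norm x) \<and> (\<forall>x. \<exists>f\<in>E. f x = norm x)"

text \<open>The finitely many other functionals are strictly below \<open>f\<close> at
  \<open>x\<close>. By continuity they stay below it at \<open>x + t *\<^sub>R v\<close> for all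
  small \<open>t > 0\<close>, so only \<open>f\<close> can attain the norm there.\<close>

lemma norm_eventually_eq_norming:
  fixes x v :: "'a :: real_normed_vector"
  assumes E: "norming_set E" and f: "f \<in> E" "f x = norm x"
    and unique: "\<And>g. g \<in> E \<Longrightarrow> g x = norm x \<Longrightarrow> g = f"
  shows "eventually (\<lambda>t. norm (x + t *\<^sub>R v) = f x + t * f v) (at_right 0)"
proof -
  have "eventually (\<lambda>t. g \<noteq> f \<longrightarrow> g (x + t *\<^sub>R v) < f (x + t *\<^sub>R v)) (at_right 0)"
    if g: "g \<in> E" for g
  proof (cases "g = f")
    case False
    then have "g x < f x"
      using E f g unique unfolding norming_set_def by (metis order_le_less)
    moreover have "((\<lambda>t. f (x + t *\<^sub>R v) - g (x + t *\<^sub>R v)) \<longlongrightarrow> f (x + 0 *\<^sub>R v) - g (x + 0 *\<^sub>R v))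
        (at_right 0)"
      by (intro tendsto_intros)
    ultimately have "eventually (\<lambda>t. 0 < f (x + t *\<^sub>R v) - g (x + t *\<^sub>R v)) (at_right 0)"
      by (intro order_tendstoD) auto
    then show ?thesis
      by eventually_elim simp
  qed simp
  then have "eventually (\<lambda>t. \<forall>g\<in>E. g \<noteq> f \<longrightarrow> g (x + t *\<^sub>R v) < f (x + t *\<^sub>R v)) (at_right 0)"
    using E by (intro eventually_ball_finite) (auto simp: norming_set_def)
  then show ?thesis
  proof eventually_elim
    case (elim t)
    obtain g where g: "g \<in> E" "g (x + t *\<^sub>R v) = norm (x + t *\<^sub>R v)"
      using E unfolding norming_set_def by blast
    have "f (x + t *\<^sub>R v) \<le> norm (x + t *\<^sub>R v)"
      using E f unfolding norming_set_def by blast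
    with elim g have "g = f"
      by force
    with g show ?case
      by (simp add: blinfun.add_right blinfun.scaleR_right)
  qed
qed

text \<open>Along \<open>v\<close> the norm initially grows with slope \<open>f v\<close>. A support
  functional \<open>g\<close> agrees with the norm at \<open>x\<close> and never exceeds it, so
  \<open>g v \<le> f v\<close>; the same inequality at \<open>- v\<close> gives equality.\<close>

lemma smooth_point_if_unique_norming:
  fixes x :: "'a :: real_normed_vector"
  assumes E: "norming_set E" and "x \<noteq> 0" and f: "f \<in> E" "f x = norm x"
    and unique: "\<And>g. g \<in> E \<Longrightarrow> g x = norm x \<Longrightarrow> g = f"
  shows "smooth_point x"
proof -
  have le: "f v \<le> norm v" for v
    using E f unfolding norming_set_def by blast
  have "norm f \<le> 1"
  proof (rule norm_blinfun_bound)
    show "norm (f v) \<le> 1 * norm v" for v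
      using le[of v] le[of "- v"] by (simp add: blinfun.minus_right)
  qed simp
  moreover have "1 * norm x \<le> norm f * norm x"
    using norm_blinfun[of f x] f by simp
  then have "1 \<le> norm f"
    using \<open>x \<noteq> 0\<close> by (subst (asm) mult_le_cancel_right) auto
  ultimately have "support_functional x f"
    using \<open>x \<noteq> 0\<close> f by (simp add: support_functional_def)
  moreover have "g = f" if g: "support_functional x g" for g
  proof -
    have g_le: "g v \<le> f v" for v
    proof -
      have "eventually (\<lambda>t. norm (x + t *\<^sub>R v) = f x + t * f v \<and> 0 < t) (at_right 0)"
        using norm_eventually_eq_norming[OF E f unique] eventually_at_right_less
        by (rule eventually_conj)
      then obtain t where t: "norm (x + t *\<^sub>R v) = f x + t * f v" "0 < t"
        using eventually_happens[of _ "at_right (0 :: real)"] by (auto simp: trivial_limit_at_right_real)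
      have "g (x + t *\<^sub>R v) \<le> norm (x + t *\<^sub>R v)"
        using norm_blinfun[of g "x + t *\<^sub>R v"] g by (simp add: support_functional_def)
      then have "t * g v \<le> t * f v"
        using t f g by (simp add: support_functional_def blinfun.add_right blinfun.scaleR_right)
      with t show ?thesis
        by simp
    qed
    have "g v = f v" for v
      using g_le[of v] g_le[of "- v"] by (simp add: blinfun.minus_right)
    then show ?thesis
      by (intro blinfun_eqI)
  qed
  ultimately show ?thesis
    using \<open>x \<noteq> 0\<close> unfolding smooth_point_def by blast
qed

text \<open>\<open>T\<close> and the weighted operator of the introduction become \<open>x\<close>
  and \<open>y\<close>. Moving from \<open>y\<close> along \<open>- x\<close> changes the norm with
  slope \<open>- norm x < 0\<close>, which refutes orthogonality of \<open>y\<close> to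
  \<open>x\<close>.\<close>

lemma not_left_symmetric_if_two_norming:
  fixes x y :: "'a :: real_normed_vector"
  assumes E: "norming_set E" and "x \<noteq> 0"
    and f: "f \<in> E" "f x = norm x" and g: "g \<in> E" "g x = norm x"
    and y: "f y = norm y" "g y \<le> 0" and unique: "\<And>h. h \<in> E \<Longrightarrow> h y = norm y \<Longrightarrow> h = f"
  shows "\<not> left_symmetric x"
proof -
  have le: "h v \<le> norm v" if "h \<in> E" for h v
    using E that unfolding norming_set_def by blast
  have "x \<bottom>\<^sub>B y"
    unfolding BJ_orthogonal_def
  proof
    fix l :: real
    show "norm x \<le> norm (x + l *\<^sub>R y)"
    \<comment> \<open>\<open>f\<close> does not decrease along \<open>y\<close> and \<open>g\<close>
      does not increase, so \<open>f\<close> handles \<open>l \<ge> 0\<close> and \<open>g\<close>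
      handles \<open>l < 0\<close>.\<close>
    proof (cases "0 \<le> l")
      case True
      then have "0 \<le> l * f y"
        using y by simp
      then show ?thesis
        using le[OF f(1), of "x + l *\<^sub>R y"] f by (simp add: blinfun.add_right blinfun.scaleR_right)
    next
      case False
      then have "0 \<le> l * g y"
        using y by (simp add: mult_nonpos_nonpos)
      then show ?thesis
        using le[OF g(1), of "x + l *\<^sub>R y"] g by (simp add: blinfun.add_right blinfun.scaleR_right)
    qed
  qed
  moreover have "\<not> y \<bottom>\<^sub>B x"
  proof -
    have "eventually (\<lambda>t. norm (y + t *\<^sub>R (- x)) = f y + t * f (- x) \<and> 0 < t) (at_right 0)"
      using norm_eventually_eq_norming[OF E f(1) y(1) unique] eventually_at_right_less
      by (rule eventually_conj)
    then obtain t where t: "norm (y + t *\<^sub>R (- x)) = f y + t * f (- x)" "0 < t"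
      using eventually_happens[of _ "at_right (0 :: real)"] by (auto simp: trivial_limit_at_right_real)
    then have "norm (y + (- t) *\<^sub>R x) < norm y"
      using f y \<open>x \<noteq> 0\<close> by (simp add: blinfun.minus_right)
    then show ?thesis
      unfolding BJ_orthogonal_def by (metis not_le)
  qed
  ultimately show ?thesis
    unfolding left_symmetric_def by blast
qed

section \<open>Matrix entries and the operator norm as a maximum over sign matrices\<close>

definition entry :: "('n :: finite) linf \<Rightarrow>\<^sub>L ('m :: finite) lone \<Rightarrow> 'm \<Rightarrow> 'n \<Rightarrow> real"
  where "entry V i j = vec_lone (blinfun_apply V (linf_vec (axis j 1))) $ i"

definition sgn_bool :: "bool \<Rightarrow> real"
  where "sgn_bool b = (if b then 1 else - 1)"

definition sign_form ::
    "('m :: finite \<Rightarrow> 'n :: finite \<Rightarrow> bool) \<Rightarrow> ('n linf \<Rightarrow>\<^sub>L 'm lone) \<Rightarrow>\<^sub>L real"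
  where "sign_form S = Blinfun (\<lambda>V. \<Sum>i\<in>UNIV. \<Sum>j\<in>UNIV. sgn_bool (S i j) * entry V i j)"

text \<open>Rank-one sign matrices: since \<open>sgn_bool (p = q) = sgn_bool p * sgn_bool q\<close>, equality of
  truth values plays the role of the product of signs.\<close>

definition rank_one_forms :: "(('n :: finite linf \<Rightarrow>\<^sub>L 'm :: finite lone) \<Rightarrow>\<^sub>L real) set"
  where "rank_one_forms = range (\<lambda>(s, t). sign_form (\<lambda>i j. s i = (t j :: bool)))"

definition matrix_op :: "('m :: finite \<Rightarrow> 'n :: finite \<Rightarrow> real) \<Rightarrow> 'n linf \<Rightarrow>\<^sub>L 'm lone"
  where "matrix_op a = Blinfun (\<lambda>x. lone_vec (\<chi> i. \<Sum>j\<in>UNIV. a i j * vec_linf x $ j))"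

lemma sgn_bool_eq: "sgn_bool (p = q) = sgn_bool p * sgn_bool q"
  by (simp add: sgn_bool_def)

lemma abs_sgn_bool [simp]: "\<bar>sgn_bool b\<bar> = 1"
  by (simp add: sgn_bool_def)

lemma sgn_bool_nonneg_mult: "sgn_bool (0 \<le> c) * c = \<bar>c\<bar>"
  by (simp add: sgn_bool_def)

lemma sgn_bool_mult_le: "sgn_bool b * c \<le> \<bar>c\<bar>"
  by (auto simp: sgn_bool_def)

lemma bounded_linear_vec_lone: "bounded_linear (\<lambda>x :: 'm :: finite lone. vec_lone x $ i)"
proof (rule bounded_linear_intro[where K = 1])
  show "norm (vec_lone x $ i) \<le> norm x * 1" for x :: "'m lone"
    unfolding norm_lone.rep_eq by (auto intro!: member_le_sum)
qed (simp_all add: plus_lone.rep_eq scaleR_lone.rep_eq)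

lemma sign_form_apply:
  "sign_form S V = (\<Sum>i\<in>UNIV. \<Sum>j\<in>UNIV. sgn_bool (S i j) * entry V i j)"
proof -
  have "bounded_linear (\<lambda>V. \<Sum>i\<in>UNIV. \<Sum>j\<in>UNIV. sgn_bool (S i j) * entry V i j)"
    unfolding entry_def
    by (intro bounded_linear_sum bounded_linear_const_mult
        bounded_linear_compose[OF bounded_linear_vec_lone] blinfun.bounded_linear_left)
  then show ?thesis
    by (simp add: sign_form_def bounded_linear_Blinfun_apply)
qed

lemma linear_matrix_op:
  "linear (\<lambda>x :: 'n linf. lone_vec (\<chi> i. \<Sum>j\<in>UNIV. a i j * vec_linf x $ j) :: 'm lone)"
  for a :: "'m :: finite \<Rightarrow> 'n :: finite \<Rightarrow> real"
proof
  fix x y :: "'n linf" and r :: real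
  show "(lone_vec (\<chi> i. \<Sum>j\<in>UNIV. a i j * vec_linf (x + y) $ j) :: 'm lone) =
      lone_vec (\<chi> i. \<Sum>j\<in>UNIV. a i j * vec_linf x $ j) +
      lone_vec (\<chi> i. \<Sum>j\<in>UNIV. a i j * vec_linf y $ j)"
    by (simp add: plus_linf.rep_eq plus_lone.abs_eq lone_vec_inject vec_eq_iff
        distrib_left sum.distrib)
  show "(lone_vec (\<chi> i. \<Sum>j\<in>UNIV. a i j * vec_linf (r *\<^sub>R x) $ j) :: 'm lone) =
      r *\<^sub>R lone_vec (\<chi> i. \<Sum>j\<in>UNIV. a i j * vec_linf x $ j)"
    by (simp add: scaleR_linf.rep_eq scaleR_lone.abs_eq lone_vec_inject vec_eq_iff
        sum_distrib_left mult.left_commute)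
qed

lemma entry_matrix_op: "entry (matrix_op a) i j = a i j"
  by (simp add: entry_def matrix_op_def lone_vec_inverse linf_vec_inverse axis_def if_distrib
      bounded_linear_Blinfun_apply[OF linear_linf_bounded_linear[OF linear_matrix_op]] cong: if_cong)

lemma vec_lone_apply_eq_sum_entry:
  fixes V :: "('n :: finite) linf \<Rightarrow>\<^sub>L ('m :: finite) lone"
  shows "vec_lone (V x) $ i = (\<Sum>j\<in>UNIV. entry V i j * vec_linf x $ j)"
proof -
  have lin: "linear (\<lambda>v. vec_lone (V (linf_vec v)) $ i)"
    by standard (simp_all add: plus_linf.abs_eq[symmetric] scaleR_linf.abs_eq[symmetric]
        blinfun.add_right blinfun.scaleR_right plus_lone.rep_eq scaleR_lone.rep_eq)
  have "vec_linf x = (\<Sum>j\<in>UNIV. (vec_linf x $ j) *\<^sub>R axis j 1)"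
    by (simp add: basis_expansion flip: scalar_mult_eq_scaleR)
  then have "vec_lone (V (linf_vec (vec_linf x))) $ i =
      vec_lone (V (linf_vec (\<Sum>j\<in>UNIV. (vec_linf x $ j) *\<^sub>R axis j 1))) $ i"
    by simp
  also have "\<dots> = (\<Sum>j\<in>UNIV. vec_linf x $ j * entry V i j)"
    by (simp add: linear_sum[OF lin] linear_scale[OF lin] entry_def)
  finally show ?thesis
    by (simp add: vec_linf_inverse mult.commute)
qed

lemma abs_vec_linf_le: "\<bar>vec_linf x $ j\<bar> \<le> norm x"
  unfolding norm_linf.rep_eq by (auto intro!: Max_ge)

text \<open>The signs \<open>t\<close> form a unit vector of the domain, and the signs
  \<open>s\<close> bound the sum norm of its image from below.\<close>

lemma rank_one_form_le_norm:
  fixes V :: "('n :: finite) linf \<Rightarrow>\<^sub>L ('m :: finite) lone"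
  shows "sign_form (\<lambda>i j. s i = (t j :: bool)) V \<le> norm V"
proof -
  define x :: "'n linf" where "x = linf_vec (\<chi> j. sgn_bool (t j))"
  have norm_x: "norm x = 1"
    unfolding x_def by (simp add: norm_linf.abs_eq)
  have "sign_form (\<lambda>i j. s i = t j) V = (\<Sum>i\<in>UNIV. sgn_bool (s i) * vec_lone (V x) $ i)"
    by (simp add: sign_form_apply vec_lone_apply_eq_sum_entry x_def linf_vec_inverse sgn_bool_eq
        sum_distrib_left algebra_simps)
  also have "\<dots> \<le> norm (V x)"
    unfolding norm_lone.rep_eq by (intro sum_mono sgn_bool_mult_le)
  also have "\<dots> \<le> norm V"
    using norm_blinfun[of V x] norm_x by simp
  finally show ?thesis .
qed

text \<open>First \<open>s\<close> is read off from the coordinates of \<open>V x\<close>, which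
  turns the sum norm into a linear expression in \<open>x\<close> with coefficients
  \<open>c j\<close>; then \<open>t\<close> is read off from the signs of these
  coefficients.\<close>

lemma norm_apply_le_rank_one_form:
  fixes V :: "('n :: finite) linf \<Rightarrow>\<^sub>L ('m :: finite) lone"
  shows "\<exists>s t. norm (V x) \<le> sign_form (\<lambda>i j. s i = (t j :: bool)) V * norm x"
proof -
  define s where "s i = (0 \<le> vec_lone (V x) $ i)" for i
  define c where "c j = (\<Sum>i\<in>UNIV. sgn_bool (s i) * entry V i j)" for j
  define t where "t j = (0 \<le> c j)" for j
  have "norm (V x) = (\<Sum>i\<in>UNIV. sgn_bool (s i) * vec_lone (V x) $ i)"
    unfolding norm_lone.rep_eq s_def by (simp only: sgn_bool_nonneg_mult)
  also have "\<dots> = (\<Sum>i\<in>UNIV. \<Sum>j\<in>UNIV. sgn_bool (s i) * entry V i j * vec_linf x $ j)"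
    by (simp add: vec_lone_apply_eq_sum_entry sum_distrib_left mult.assoc)
  also have "\<dots> = (\<Sum>j\<in>UNIV. c j * vec_linf x $ j)"
    by (subst sum.swap) (simp add: c_def sum_distrib_right)
  also have "\<dots> \<le> (\<Sum>j\<in>UNIV. \<bar>c j\<bar> * norm x)"
  proof (rule sum_mono)
    fix j
    have "c j * vec_linf x $ j \<le> \<bar>c j\<bar> * \<bar>vec_linf x $ j\<bar>"
      by (metis abs_ge_self abs_mult)
    also have "\<dots> \<le> \<bar>c j\<bar> * norm x"
      by (intro mult_left_mono abs_vec_linf_le) simp
    finally show "c j * vec_linf x $ j \<le> \<bar>c j\<bar> * norm x" .
  qed
  also have "\<dots> = (\<Sum>j\<in>UNIV. sgn_bool (t j) * c j) * norm x"
    by (simp only: t_def sgn_bool_nonneg_mult sum_distrib_right)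
  also have "(\<Sum>j\<in>UNIV. sgn_bool (t j) * c j) = sign_form (\<lambda>i j. s i = t j) V"
    unfolding sign_form_apply c_def sum_distrib_left
    by (subst sum.swap) (simp add: sgn_bool_eq mult_ac)
  finally show ?thesis
    by blast
qed

lemma norming_set_rank_one_forms:
  "norming_set (rank_one_forms :: (('n :: finite linf \<Rightarrow>\<^sub>L 'm :: finite lone) \<Rightarrow>\<^sub>L real) set)"
proof -
  have fin: "finite (rank_one_forms :: (('n linf \<Rightarrow>\<^sub>L 'm lone) \<Rightarrow>\<^sub>L real) set)"
    unfolding rank_one_forms_def by simp
  have le: "f V \<le> norm V" if "f \<in> rank_one_forms" for f and V :: "'n linf \<Rightarrow>\<^sub>L 'm lone"
    using that by (auto simp: rank_one_forms_def rank_one_form_le_norm)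
  have "\<exists>f\<in>rank_one_forms. f V = norm V" for V :: "'n linf \<Rightarrow>\<^sub>L 'm lone"
  proof -
    define M where "M = (\<lambda>f. blinfun_apply f V) ` rank_one_forms"
    have M: "finite M" "M \<noteq> {}"
      unfolding M_def using fin by (auto simp: rank_one_forms_def)
    have bound: "norm (V x) \<le> Max M * norm x" for x
    proof -
      obtain s t :: "_ \<Rightarrow> bool" where st: "norm (V x) \<le> sign_form (\<lambda>i j. s i = t j) V * norm x"
        using norm_apply_le_rank_one_form by blast
      have "sign_form (\<lambda>i j. s i = t j) V \<in> M"
        unfolding M_def rank_one_forms_def by (rule imageI) auto
      then have "sign_form (\<lambda>i j. s i = t j) V \<le> Max M"
        using M by simp
      then show ?thesis
        using st by (meson mult_right_mono norm_ge_zero order_trans)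
    qed
    \<comment> \<open>Any unit vector would do: \<open>norm_blinfun_bound\<close> needs a
      nonnegative constant.\<close>
    have "norm (V (linf_vec (\<chi> j. 1))) \<le> Max M"
      using bound[of "linf_vec (\<chi> j. 1)"] by (simp add: norm_linf.abs_eq)
    then have "0 \<le> Max M"
      using norm_ge_zero order_trans by blast
    then have "norm V \<le> Max M"
      using bound by (intro norm_blinfun_bound)
    moreover obtain f where f: "f \<in> rank_one_forms" "f V = Max M"
      using Max_in[OF M] unfolding M_def by auto
    ultimately show ?thesis
      using le[OF f(1), of V] f by (metis order_antisym)
  qed
  with fin le show ?thesis
    unfolding norming_set_def by blast
qed

section \<open>Weighted sign matrices\<close>

text \<open>The summands for \<open>S\<close> are the weights themselves, those for
  \<open>S'\<close> are the weights up to sign, with a minus exactly where the matrices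
  differ.\<close>

lemma sign_form_less_weighted:
  assumes w: "\<And>i j. 0 < w i j" and "S' \<noteq> S"
  shows "sign_form S' (matrix_op (\<lambda>i j. w i j * sgn_bool (S i j))) <
    sign_form S (matrix_op (\<lambda>i j. w i j * sgn_bool (S i j)))"
proof -
  let ?p = "\<lambda>S' i j. sgn_bool (S' i j) * (w i j * sgn_bool (S i j))"
  have le: "?p S' i j \<le> ?p S i j" for i j
    using w[of i j] by (simp add: sgn_bool_def)
  obtain i j where "S' i j \<noteq> S i j"
    using \<open>S' \<noteq> S\<close> by blast
  then have "?p S' i j < ?p S i j"
    using w[of i j] by (simp add: sgn_bool_def)
  then have "(\<Sum>j\<in>UNIV. ?p S' i j) < (\<Sum>j\<in>UNIV. ?p S i j)"
    using le by (intro sum_strict_mono_ex1) auto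
  then show ?thesis
    unfolding sign_form_apply entry_matrix_op
    using le by (intro sum_strict_mono_ex1) (auto intro: sum_mono)
qed

lemma exists_separating_weights:
  fixes S S' :: "'m :: finite \<Rightarrow> 'n :: finite \<Rightarrow> bool"
  assumes "S' \<noteq> S"
  shows "\<exists>w. (\<forall>i j. 0 < w i j) \<and> sign_form S' (matrix_op (\<lambda>i j. w i j * sgn_bool (S i j))) \<le> 0"
proof -
  obtain a b where ab: "S' a b \<noteq> S a b"
    using assms by blast
  define N where "N = real (CARD('m) * CARD('n))"
  define w where "w i j = (if i = a \<and> j = b then N else 1)" for i j
  have "0 < N"
    by (simp add: N_def)
  then have w: "0 < w i j" for i j
    by (simp add: w_def)
  \<comment> \<open>At the entry \<open>a\<close>, \<open>b\<close> the left side is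
    \<open>- N\<close>, elsewhere at most 1. Weakening \<open>- N\<close> to \<open>1 - N\<close>
    makes the bounds sum to exactly 0, since \<open>N\<close> is the number of entries.\<close>
  have "sgn_bool (S' i j) * (w i j * sgn_bool (S i j)) \<le> 1 - (if i = a \<and> j = b then N else 0)"
    for i j
    using ab by (auto simp: w_def sgn_bool_def)
  then have "sign_form S' (matrix_op (\<lambda>i j. w i j * sgn_bool (S i j))) \<le>
      (\<Sum>i\<in>UNIV. \<Sum>j\<in>UNIV. 1 - (if i = a \<and> j = b then N else 0))"
    unfolding sign_form_apply entry_matrix_op by (intro sum_mono)
  also have "\<dots> = (\<Sum>i\<in>UNIV. real CARD('n) - (if i = a then N else 0))"
    by (intro sum.cong refl) (auto simp: sum_subtractf)
  also have "\<dots> = 0"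
    by (simp add: sum_subtractf N_def)
  finally show ?thesis
    using w by blast
qed

theorem theorem10:
  fixes T :: "('n :: finite) linf \<Rightarrow>\<^sub>L ('m :: finite) lone"
  assumes "T \<noteq> 0"
    and "left_symmetric T"
  shows "smooth_point T"
proof -
  note E = norming_set_rank_one_forms
  obtain f where f: "f \<in> rank_one_forms" "f T = norm T"
    using E unfolding norming_set_def by blast
  \<comment> \<open>Uniqueness concerns functionals, not pairs of sign vectors: negating both
    \<open>s\<close> and \<open>t\<close> leaves the form unchanged.\<close>
  have "g = f" if g: "g \<in> rank_one_forms" "g T = norm T" for g
  proof (rule ccontr)
    assume "g \<noteq> f"
    obtain S where S: "f = sign_form S"
      using f unfolding rank_one_forms_def by auto
    obtain S' where S': "g = sign_form S'"
      using g unfolding rank_one_forms_def by auto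
    have "S' \<noteq> S"
      using \<open>g \<noteq> f\<close> S S' by blast
    then obtain w where w: "\<And>i j. 0 < w i j"
      and le_0: "g (matrix_op (\<lambda>i j. w i j * sgn_bool (S i j))) \<le> 0"
      using exists_separating_weights[of S' S] unfolding S' by blast
    define y where "y = matrix_op (\<lambda>i j. w i j * sgn_bool (S i j))"
    have less: "h y < f y" if h: "h \<in> rank_one_forms" "h \<noteq> f" for h
    proof -
      obtain R where "h = sign_form R"
        using h(1) unfolding rank_one_forms_def by auto
      then show ?thesis
        using h sign_form_less_weighted[of w R S] w unfolding y_def S by blast
    qed
    \<comment> \<open>Some form attains \<open>norm y\<close>; as \<open>f\<close> strictly exceeds
      all others at \<open>y\<close>, it must be \<open>f\<close>.\<close>
    obtain h where h: "h \<in> rank_one_forms" "h y = norm y"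
      using E unfolding norming_set_def by blast
    have "f y \<le> norm y"
      using E f unfolding norming_set_def by blast
    then have fy: "f y = norm y"
      using h less by force
    have "\<not> left_symmetric T"
      using E assms(1) f g fy
    proof (rule not_left_symmetric_if_two_norming)
      show "g y \<le> 0"
        using le_0 by (simp add: y_def)
      show "h = f" if "h \<in> rank_one_forms" "h y = norm y" for h
        using less[of h] that fy by force
    qed
    with assms(2) show False
      by blast
  qed
  with smooth_point_if_unique_norming[OF E assms(1) f] show ?thesis
    by blast
qed

end
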